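(* The Paving Conjecture has a positive solution if any one of the following classes of operators satisfies the Paving Conjecture: (1) unitary operators; (2) orthogonal projections; (3) positive operators; (4) self-adjoint operators; (5) Gram matrices $(\langle f_i,f_j\rangle)_{i,j\in I}$, where $T:\ell_2(I)\to\ell_2(I)$ is a bounded linear operator with $Te_i=f_i$ and $\|Te_i\|=1$ for all $i\in I$; (6) invertible operators (or invertible operators with zero diagonal).
   Context: $\ell_2^n$ is the complex $n$-dimensional Hilbert space with fixed orthonormal basis $\{e_i\}_{i=1}^n$; more generally $\ell_2(I)$ has fixed orthonormal basis $\{e_i\}_{i\in I}$. Matrices of operators are taken with respect to this basis. For a subset $A$ of the index set, $Q_A$ is the diagonal projection (diagonal matrix with entry $1$ at $(i,i)$ for $i\in A$, all other entries $0$). $D(T)$ denotes the diagonal of $T$ (the diagonal operator with the same diagonal entries as $T$). Paving Conjecture (PC): for every $\epsilon>0$ there is a natural number $r$ such that for every natural number $n$ and every linear operator $T$ on $\ell_2^n$ whose matrix has zero diagonal, there is a partition $\{A_j\}_{j=1}^r$ of $\{1,\dots,n\}$ with $\|Q_{A_j}TQ_{A_j}\|\le\epsilon\|T\|$ for all $j=1,\dots,r$. A class $\mathcal C$ of operators satisfies PC if for every $\epsilon>0$ there is a natural number $r$ such that for every $n$ and every $T\in\mathcal C$ acting on $\ell_2^n$ there is a partition $\{A_j\}_{j=1}^r$ of $\{1,\dots,n\}$ with $\|Q_{A_j}(T-D(T))Q_{A_j}\|\le\epsilon\|T-D(T)\|$ for all $j$. (In (5), $I=\{1,\dots,n\}$,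 so $\ell_2(I)=\ell_2^n$.) In (6), each of the two alternatives (invertible operators; invertible operators with zero diagonal) is by itself a sufficient class. *)

theory Defs
  imports
    "HOL-Analysis.L2_Norm"
    "HOL-Library.Disjoint_Sets"
    "Jordan_Normal_Form.Schur_Decomposition"
begin

text \<open>
  A linear operator on the complex Hilbert space of dimension \<open>n\<close> is represented by its matrix
  with respect to the fixed orthonormal basis, an element of \<open>carrier_mat n n\<close>. Following the
  matrix library, the index set is \<open>{..<n}\<close> instead of \<open>{1..n}\<close>. The inner product of \<open>v\<close> and \<open>w\<close>
  is \<open>v \<bullet>c w\<close>, which is linear in \<open>v\<close> and conjugate-linear in \<open>w\<close>.
\<close>

definition vec_norm :: "complex vec \<Rightarrow> real" where
  "vec_norm v = L2_set (\<lambda>i. cmod (v $ i)) {..<dim_vec v}"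

definition op_norm :: "complex mat \<Rightarrow> real" where
  "op_norm T = (SUP v \<in> {v \<in> carrier_vec (dim_col T). vec_norm v \<le> 1}. vec_norm (T *\<^sub>v v))"

definition diag_proj :: "nat \<Rightarrow> nat set \<Rightarrow> complex mat" where
  "diag_proj n A = mat n n (\<lambda>(i, j). if i = j \<and> i \<in> A then 1 else 0)"

definition diag_part :: "complex mat \<Rightarrow> complex mat" where
  "diag_part T = mat (dim_row T) (dim_col T) (\<lambda>(i, j). if i = j then T $$ (i, i) else 0)"

definition zero_diagonal :: "complex mat \<Rightarrow> bool" where
  "zero_diagonal T \<longleftrightarrow> (\<forall>i < dim_row T. T $$ (i, i) = 0)"

text \<open>
  A partition into \<open>r\<close> labelled parts \<open>A 0, \<dots>, A (r - 1)\<close>. Parts may be empty, because \<open>r\<close> is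
  chosen before \<open>n\<close> and may exceed it.
\<close>

definition index_partition :: "nat \<Rightarrow> nat \<Rightarrow> (nat \<Rightarrow> nat set) \<Rightarrow> bool" where
  "index_partition n r A \<longleftrightarrow> disjoint_family_on A {..<r} \<and> (\<Union>j<r. A j) = {..<n}"

definition paving_conjecture :: bool where
  "paving_conjecture \<longleftrightarrow>
    (\<forall>\<epsilon>::real. \<epsilon> > 0 \<longrightarrow> (\<exists>r::nat. \<forall>n::nat. \<forall>T \<in> carrier_mat n n. zero_diagonal T \<longrightarrow>
      (\<exists>A. index_partition n r A \<and>
        (\<forall>j<r. op_norm (diag_proj n (A j) * T * diag_proj n (A j)) \<le> \<epsilon> * op_norm T))))"

definition satisfies_paving :: "complex mat set \<Rightarrow> bool" where
  "satisfies_paving \<C> \<longleftrightarrow>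
    (\<forall>\<epsilon>::real. \<epsilon> > 0 \<longrightarrow> (\<exists>r::nat. \<forall>n::nat. \<forall>T \<in> \<C> \<inter> carrier_mat n n.
      (\<exists>A. index_partition n r A \<and>
        (\<forall>j<r. op_norm (diag_proj n (A j) * (T - diag_part T) * diag_proj n (A j))
                 \<le> \<epsilon> * op_norm (T - diag_part T)))))"

definition unitary_ops :: "complex mat set" where
  "unitary_ops = {T. square_mat T \<and> inverts_mat T (mat_adjoint T) \<and> inverts_mat (mat_adjoint T) T}"

definition self_adjoint_ops :: "complex mat set" where
  "self_adjoint_ops = {T. square_mat T \<and> mat_adjoint T = T}"

definition orthogonal_projections :: "complex mat set" where
  "orthogonal_projections = {T. square_mat T \<and> T * T = T \<and> mat_adjoint T = T}"

text \<open>In the order on \<open>complex\<close>, \<open>0 \<le> z\<close> means that \<open>z\<close> is real and nonnegative.\<close>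

definition positive_ops :: "complex mat set" where
  "positive_ops = {T. square_mat T \<and> (\<forall>v \<in> carrier_vec (dim_col T). 0 \<le> (T *\<^sub>v v) \<bullet>c v)}"

definition gram_matrix :: "nat \<Rightarrow> (nat \<Rightarrow> complex vec) \<Rightarrow> complex mat" where
  "gram_matrix n f = mat n n (\<lambda>(i, j). f i \<bullet>c f j)"

definition unit_gram_matrices :: "complex mat set" where
  "unit_gram_matrices =
    {gram_matrix n f | n f. \<exists>T \<in> carrier_mat n n.
       \<forall>i<n. T *\<^sub>v unit_vec n i = f i \<and> vec_norm (T *\<^sub>v unit_vec n i) = 1}"

definition invertible_ops :: "complex mat set" where
  "invertible_ops = {T. invertible_mat T}"

definition invertible_zero_diagonal_ops :: "complex mat set" where
  "invertible_zero_diagonal_ops = {T. invertible_mat T \<and> zero_diagonal T}"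

end

theory Submission
  imports Defs
begin

text \<open>
  Paving concerns only the off-diagonal entries of a matrix, and it passes to corners: if \<open>S\<close> agrees
  off the diagonal with \<open>c\<close> times the upper left corner of a larger matrix \<open>M\<close>, then a paving of
  \<open>M\<close>, cut down to the first \<open>n\<close> indices, paves \<open>S\<close>, with the constants compared through
  \<open>c * op_norm (M - diag_part M)\<close>. So a class satisfying the paving property yields the conjecture
  once it contains, for every matrix \<open>S\<close> of interest, such an \<open>M\<close> whose off-diagonal part is bounded
  uniformly. It is enough to treat self-adjoint contractions \<open>S\<close> with zero diagonal: a general \<open>T\<close>
  with zero diagonal is \<open>op_norm T\<close> times \<open>R + \<i> J\<close> for two of these, and the common refinement of a
  paving of \<open>R\<close> and a paving of \<open>J\<close> paves \<open>T\<close>. The resulting criterion is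
  \<open>paving_conjecture_from_dilations\<close>.

  The matrices \<open>M\<close> are as follows.
  \<^item> Gram matrices of unit vectors: \<open>M = 1 + S\<close>. It is positive semidefinite with unit diagonal, and
    every positive semidefinite matrix is \<open>X X\<^sup>*\<close>, hence the Gram matrix of the rows of \<open>X\<close>.
  \<^item> Orthogonal projections: \<open>A = (1 + S) / 2\<close> satisfies \<open>0 \<le> A \<le> 1\<close> and is the corner of a
    projection of twice the size. Factor \<open>A = X X\<^sup>*\<close> and \<open>1 - X\<^sup>* X = Z Z\<^sup>*\<close>; the block column \<open>V\<close> of
    \<open>X\<close> and \<open>Z\<^sup>*\<close> is an isometry, and \<open>V V\<^sup>*\<close> is the projection.
  \<^item> Unitary operators: the reflection \<open>2 P - 1\<close> in that projection \<open>P\<close>.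
  \<^item> Invertible operators with zero diagonal: the block matrix with rows \<open>(S, 1)\<close> and \<open>(1, 0)\<close>.

  The remaining classes contain one of these, and the paving property is inherited by smaller classes.
  The factorization \<open>X X\<^sup>*\<close> is a Cholesky decomposition (\<open>cholesky_fun\<close>).
\<close>

section \<open>Norms, inner products and adjoints\<close>

lemma vec_norm_nonneg: "0 \<le> vec_norm v"
  by (simp add: vec_norm_def L2_set_nonneg)

lemma vec_norm_zero: "vec_norm (0\<^sub>v n) = 0"
  by (simp add: vec_norm_def L2_set_def)

lemma vec_norm_smult: "vec_norm (c \<cdot>\<^sub>v v) = cmod c * vec_norm v"
  by (simp add: vec_norm_def norm_mult L2_set_right_distrib cong: L2_set_cong_simp)

lemma vec_norm_triangle:
  assumes "dim_vec v = dim_vec w"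
  shows "vec_norm (v + w) \<le> vec_norm v + vec_norm w"
proof -
  have "vec_norm (v + w) = L2_set (\<lambda>i. cmod (v $ i + w $ i)) {..<dim_vec w}"
    unfolding vec_norm_def by (intro L2_set_cong) auto
  also have "\<dots> \<le> L2_set (\<lambda>i. cmod (v $ i) + cmod (w $ i)) {..<dim_vec w}"
    by (intro L2_set_mono norm_triangle_ineq) auto
  also have "\<dots> \<le> vec_norm v + vec_norm w"
    unfolding vec_norm_def assms by (rule L2_set_triangle_ineq)
  finally show ?thesis .
qed

lemma vec_norm_le_entries:
  assumes "dim_vec v \<le> dim_vec w" "0 \<le> c"
    and "\<And>i. i < dim_vec v \<Longrightarrow> cmod (v $ i) \<le> c * cmod (w $ i)"
  shows "vec_norm v \<le> c * vec_norm w"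
proof -
  have "vec_norm v \<le> L2_set (\<lambda>i. c * cmod (w $ i)) {..<dim_vec v}"
    unfolding vec_norm_def by (intro L2_set_mono) (use assms in auto)
  also have "\<dots> \<le> L2_set (\<lambda>i. c * cmod (w $ i)) {..<dim_vec w}"
    unfolding L2_set_def by (intro real_sqrt_le_mono sum_mono2) (use assms in auto)
  also have "\<dots> = c * vec_norm w"
    unfolding vec_norm_def by (simp add: L2_set_right_distrib assms)
  finally show ?thesis .
qed

lemma entry_le_vec_norm: "i < dim_vec v \<Longrightarrow> cmod (v $ i) \<le> vec_norm v"
  unfolding vec_norm_def by (intro member_le_L2_set) auto

lemma sum_lessThan_add:
  fixes f :: "nat \<Rightarrow> 'a :: comm_monoid_add"
  shows "sum f {..<n + m} = sum f {..<n} + (\<Sum>k<m. f (n + k))"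
  by (induction m) (auto simp: add.assoc)

lemma vec_norm_append: "vec_norm (v @\<^sub>v w) \<le> vec_norm v + vec_norm w"
proof -
  have split: "v @\<^sub>v w = (v @\<^sub>v 0\<^sub>v (dim_vec w)) + (0\<^sub>v (dim_vec v) @\<^sub>v w)"
    by (intro eq_vecI) auto
  have 1: "vec_norm (v @\<^sub>v 0\<^sub>v (dim_vec w)) = vec_norm v"
    unfolding vec_norm_def L2_set_def
    by (intro arg_cong[where f = sqrt] sum.mono_neutral_cong_right) auto
  have 2: "vec_norm (0\<^sub>v (dim_vec v) @\<^sub>v w) = vec_norm w"
    unfolding vec_norm_def L2_set_def by (simp add: sum_lessThan_add)
  show ?thesis
    using vec_norm_triangle[of "v @\<^sub>v 0\<^sub>v (dim_vec w)" "0\<^sub>v (dim_vec v) @\<^sub>v w"]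
    by (simp add: 1 2 flip: split)
qed

lemma inner_self: "v \<bullet>c v = of_real ((vec_norm v)\<^sup>2)"
  by (simp add: vec_norm_def L2_set_def scalar_prod_def sum_nonneg lessThan_atLeast0 complex_mult_cnj
      cmod_power2)

lemma cauchy_schwarz:
  assumes "dim_vec v = dim_vec w"
  shows "cmod (v \<bullet>c w) \<le> vec_norm v * vec_norm w"
proof -
  have "cmod (v \<bullet>c w) \<le> (\<Sum>i<dim_vec w. \<bar>cmod (v $ i)\<bar> * \<bar>cmod (w $ i)\<bar>)"
    unfolding scalar_prod_def by (simp add: lessThan_atLeast0, rule sum_norm_le) (auto simp: norm_mult)
  also have "\<dots> \<le> vec_norm v * vec_norm w"
    unfolding vec_norm_def assms by (rule L2_set_mult_ineq)
  finally show ?thesis .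
qed

lemma dim_mat_adjoint [simp]:
  "dim_row (mat_adjoint A) = dim_col A" "dim_col (mat_adjoint A) = dim_row A"
  by (simp_all add: mat_adjoint_def)

lemma mat_adjoint_carrier [simp]:
  "A \<in> carrier_mat m n \<Longrightarrow> mat_adjoint A \<in> carrier_mat n m"
  by auto

lemma index_mat_adjoint [simp]:
  fixes A :: "complex mat"
  assumes "i < dim_col A" "j < dim_row A"
  shows "mat_adjoint A $$ (i, j) = cnj (A $$ (j, i))"
  using assms by (simp add: mat_adjoint_def mat_of_rows_def)

lemma mat_adjoint_adjoint [simp]: "mat_adjoint (mat_adjoint A) = (A :: complex mat)"
  by (intro eq_matI) auto

lemma mat_adjoint_mult:
  fixes A B :: "complex mat"
  assumes "A \<in> carrier_mat k m" "B \<in> carrier_mat m n"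
  shows "mat_adjoint (A * B) = mat_adjoint B * mat_adjoint A"
  using assms by (intro eq_matI) (auto simp: scalar_prod_def mult.commute)

lemma inner_adjoint:
  fixes A :: "complex mat"
  assumes A: "A \<in> carrier_mat m n" and v: "v \<in> carrier_vec n" and w: "w \<in> carrier_vec m"
  shows "(A *\<^sub>v v) \<bullet>c w = v \<bullet>c (mat_adjoint A *\<^sub>v w)"
proof -
  have "(A *\<^sub>v v) \<bullet>c w = (\<Sum>i<m. \<Sum>j<n. A $$ (i, j) * v $ j * cnj (w $ i))"
    using A v w by (auto simp: scalar_prod_def lessThan_atLeast0 sum_distrib_right intro!: sum.cong)
  also have "\<dots> = (\<Sum>j<n. \<Sum>i<m. A $$ (i, j) * v $ j * cnj (w $ i))"
    by (rule sum.swap)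
  also have "\<dots> = v \<bullet>c (mat_adjoint A *\<^sub>v w)"
    using A v w
    by (auto simp: scalar_prod_def lessThan_atLeast0 sum_distrib_left ac_simps intro!: sum.cong)
  finally show ?thesis .
qed

lemma inner_add_left:
  fixes u v w :: "complex vec"
  assumes "u \<in> carrier_vec n" "v \<in> carrier_vec n" "w \<in> carrier_vec n"
  shows "(u + v) \<bullet>c w = u \<bullet>c w + v \<bullet>c w"
  using assms by (intro add_scalar_prod_distrib[where n = n]) auto

lemma smult_mat_mult_vec:
  fixes A :: "complex mat"
  assumes "A \<in> carrier_mat m n" "v \<in> carrier_vec n"
  shows "(c \<cdot>\<^sub>m A) *\<^sub>v v = c \<cdot>\<^sub>v (A *\<^sub>v v)"
  using assms by (intro eq_vecI) auto

lemma mat_adjoint_one [simp]: "mat_adjoint (1\<^sub>m n :: complex mat) = 1\<^sub>m n"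
  by (intro eq_matI) auto

lemma mat_adjoint_add:
  fixes A B :: "complex mat"
  assumes "A \<in> carrier_mat m n" "B \<in> carrier_mat m n"
  shows "mat_adjoint (A + B) = mat_adjoint A + mat_adjoint B"
  using assms by (intro eq_matI) auto

lemma mat_adjoint_smult: "mat_adjoint (c \<cdot>\<^sub>m A) = cnj c \<cdot>\<^sub>m mat_adjoint A"
  by (intro eq_matI) auto

section \<open>The operator norm\<close>

text \<open>
  Without boundedness the supremum defining the operator norm would be an unspecified value; the sum of
  the absolute values of all entries is a crude bound.
\<close>

lemma bdd_above_op_norm:
  "bdd_above ((\<lambda>v. vec_norm (T *\<^sub>v v)) ` {v \<in> carrier_vec (dim_col T). vec_norm v \<le> 1})"
proof (intro bdd_aboveI2)
  fix v assume v: "v \<in> {v \<in> carrier_vec (dim_col T). vec_norm v \<le> 1}"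
  have le1: "cmod (v $ j) \<le> 1" if "j < dim_col T" for j
    using entry_le_vec_norm[of j v] that v by auto
  have "vec_norm (T *\<^sub>v v) \<le> (\<Sum>i<dim_row T. cmod ((T *\<^sub>v v) $ i))"
    unfolding vec_norm_def using L2_set_le_sum[of "{..<dim_row T}" "\<lambda>i. cmod ((T *\<^sub>v v) $ i)"] by simp
  also have "\<dots> \<le> (\<Sum>i<dim_row T. \<Sum>j<dim_col T. cmod (T $$ (i, j)))"
  proof (intro sum_mono)
    fix i assume i: "i \<in> {..<dim_row T}"
    have "(T *\<^sub>v v) $ i = (\<Sum>j<dim_col T. T $$ (i, j) * v $ j)"
      using i v by (auto simp: scalar_prod_def lessThan_atLeast0)
    also have "cmod \<dots> \<le> (\<Sum>j<dim_col T. cmod (T $$ (i, j)))"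
      by (intro sum_norm_le) (auto simp: norm_mult intro!: mult_left_le le1)
    finally show "cmod ((T *\<^sub>v v) $ i) \<le> (\<Sum>j<dim_col T. cmod (T $$ (i, j)))" .
  qed
  finally show "vec_norm (T *\<^sub>v v) \<le> (\<Sum>i<dim_row T. \<Sum>j<dim_col T. cmod (T $$ (i, j)))" .
qed

lemma op_norm_nonneg: "0 \<le> op_norm T"
proof -
  have "vec_norm (T *\<^sub>v 0\<^sub>v (dim_col T)) \<le> op_norm T"
    unfolding op_norm_def by (intro cSUP_upper bdd_above_op_norm) (simp add: vec_norm_zero)
  then show ?thesis
    using vec_norm_nonneg order_trans by blast
qed

lemma vec_norm_mult_le:
  assumes "T \<in> carrier_mat m n" "v \<in> carrier_vec n"
  shows "vec_norm (T *\<^sub>v v) \<le> op_norm T * vec_norm v"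
proof (cases "vec_norm v = 0")
  case True
  then have "v = 0\<^sub>v n"
    using assms(2) conjugate_square_eq_0_vec[OF assms(2)] inner_self[of v] by simp
  then have "T *\<^sub>v v = 0\<^sub>v m"
    using assms(1) by auto
  with True show ?thesis by (simp add: vec_norm_zero)
next
  case False
  define u where "u = complex_of_real (1 / vec_norm v) \<cdot>\<^sub>v v"
  have u: "u \<in> carrier_vec n" "vec_norm u = 1"
    using assms False vec_norm_nonneg[of v] by (auto simp: u_def vec_norm_smult norm_divide)
  have "vec_norm (T *\<^sub>v u) \<le> op_norm T"
    unfolding op_norm_def by (intro cSUP_upper bdd_above_op_norm) (use u assms in auto)
  moreover have "T *\<^sub>v u = complex_of_real (1 / vec_norm v) \<cdot>\<^sub>v (T *\<^sub>v v)"
    unfolding u_def using assms by (simp add: mult_mat_vec)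
  ultimately show ?thesis
    using False vec_norm_nonneg[of v] by (simp add: vec_norm_smult norm_divide field_simps)
qed

lemma op_norm_leI:
  assumes "T \<in> carrier_mat m n" "0 \<le> b"
    and "\<And>v. v \<in> carrier_vec n \<Longrightarrow> vec_norm (T *\<^sub>v v) \<le> b * vec_norm v"
  shows "op_norm T \<le> b"
  unfolding op_norm_def
proof (rule cSUP_least)
  show "{v \<in> carrier_vec (dim_col T). vec_norm v \<le> 1} \<noteq> {}"
    using vec_norm_zero[of "dim_col T"] by (auto intro!: exI[of _ "0\<^sub>v (dim_col T)"])
  fix v assume "v \<in> {v \<in> carrier_vec (dim_col T). vec_norm v \<le> 1}"
  then show "vec_norm (T *\<^sub>v v) \<le> b"
    using assms(3)[of v] mult_left_le[of "vec_norm v" b] assms(1,2) by auto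
qed

lemma op_norm_add:
  assumes "S \<in> carrier_mat m n" "T \<in> carrier_mat m n"
  shows "op_norm (S + T) \<le> op_norm S + op_norm T"
proof (rule op_norm_leI)
  fix v :: "complex vec" assume v: "v \<in> carrier_vec n"
  have "vec_norm ((S + T) *\<^sub>v v) \<le> vec_norm (S *\<^sub>v v) + vec_norm (T *\<^sub>v v)"
    using assms v by (simp add: add_mult_distrib_mat_vec vec_norm_triangle)
  also have "\<dots> \<le> op_norm S * vec_norm v + op_norm T * vec_norm v"
    using assms v by (intro add_mono vec_norm_mult_le)
  finally show "vec_norm ((S + T) *\<^sub>v v) \<le> (op_norm S + op_norm T) * vec_norm v"
    by (simp add: algebra_simps)
qed (use assms in \<open>auto simp: op_norm_nonneg\<close>)

lemma entry_le_op_norm: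
  assumes "T \<in> carrier_mat m n" "i < m" "j < n"
  shows "cmod (T $$ (i, j)) \<le> op_norm T"
proof -
  have "(T *\<^sub>v unit_vec n j) $ i = T $$ (i, j)"
    using assms by (simp add: scalar_prod_right_unit)
  moreover have "vec_norm (unit_vec n j :: complex vec) \<le> 1"
    using inner_self[of "unit_vec n j"] assms
    by (simp add: scalar_prod_def vec_norm_def L2_set_def if_distrib[of cmod]
        if_distrib[of "\<lambda>x. x ^ 2"] cong: if_cong)
  ultimately show ?thesis
    using entry_le_vec_norm[of i "T *\<^sub>v unit_vec n j"] assms
      vec_norm_mult_le[OF assms(1), of "unit_vec n j"] mult_left_le[OF _ op_norm_nonneg]
    by (smt (verit) carrier_matD(1) dim_mult_mat_vec unit_vec_carrier)
qed

text \<open>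
  From \<open>\<parallel>T\<^sup>* v\<parallel>\<^sup>2 = \<langle>T T\<^sup>* v, v\<rangle> \<le> \<parallel>T\<parallel> \<parallel>T\<^sup>* v\<parallel> \<parallel>v\<parallel>\<close>, after cancelling one factor.
\<close>

lemma op_norm_adjoint:
  assumes T: "T \<in> carrier_mat m n"
  shows "op_norm (mat_adjoint T) \<le> op_norm T"
proof (rule op_norm_leI)
  show "mat_adjoint T \<in> carrier_mat n m" using T by simp
  fix v :: "complex vec" assume v: "v \<in> carrier_vec m"
  let ?w = "mat_adjoint T *\<^sub>v v"
  have w: "?w \<in> carrier_vec n"
    by (rule mult_mat_vec_carrier[OF mat_adjoint_carrier[OF T] v])
  have "(T *\<^sub>v ?w) \<bullet>c v = ?w \<bullet>c ?w"
    by (rule inner_adjoint[OF T w v])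
  then have "(vec_norm ?w)\<^sup>2 = cmod ((T *\<^sub>v ?w) \<bullet>c v)"
    by (simp add: inner_self norm_power vec_norm_nonneg)
  also have "\<dots> \<le> vec_norm (T *\<^sub>v ?w) * vec_norm v"
    by (rule cauchy_schwarz) (use T v in auto)
  also have "\<dots> \<le> op_norm T * vec_norm ?w * vec_norm v"
    by (intro mult_right_mono vec_norm_mult_le[OF T w] vec_norm_nonneg)
  finally have "vec_norm ?w * vec_norm ?w \<le> (op_norm T * vec_norm v) * vec_norm ?w"
    by (simp add: power2_eq_square mult_ac)
  then show "vec_norm ?w \<le> op_norm T * vec_norm v"
    using vec_norm_nonneg[of ?w] vec_norm_nonneg[of v] op_norm_nonneg[of T]
    by (metis mult_le_cancel_right_pos mult_nonneg_nonneg order_le_less)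
qed (rule op_norm_nonneg)

lemma op_norm_diag_part:
  assumes T: "T \<in> carrier_mat n n"
  shows "op_norm (diag_part T) \<le> op_norm T"
proof (rule op_norm_leI)
  show D: "diag_part T \<in> carrier_mat n n" using T by (auto simp: diag_part_def)
  fix v :: "complex vec" assume v: "v \<in> carrier_vec n"
  have "(diag_part T *\<^sub>v v) $ i = T $$ (i, i) * v $ i" if "i < n" for i
    using T v that
    by (simp add: diag_part_def scalar_prod_def if_distrib[of "\<lambda>x. x * _"] cong: if_cong)
  then show "vec_norm (diag_part T *\<^sub>v v) \<le> op_norm T * vec_norm v"
    using T v D
    by (intro vec_norm_le_entries)
      (auto simp: norm_mult op_norm_nonneg intro!: mult_right_mono entry_le_op_norm)
qed (rule op_norm_nonneg)

text \<open>
  The common source of all comparisons between compressions below: the compression to \<open>A\<close> is the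
  big matrix acting on vectors that are cut down to \<open>A\<close> and padded with zeros, and neither cutting nor
  padding increases a norm. It covers the passage to a corner, to a smaller index set, and scaling.
\<close>

lemma op_norm_corner_le:
  assumes S: "S \<in> carrier_mat n n" and M: "M \<in> carrier_mat m m" and nm: "n \<le> m"
    and ent: "\<And>i j. i < n \<Longrightarrow> j < n \<Longrightarrow>
      S $$ (i, j) = (if i \<in> A \<and> j \<in> A then c * M $$ (i, j) else 0)"
  shows "op_norm S \<le> cmod c * op_norm M"
proof (rule op_norm_leI[OF S])
  fix v :: "complex vec" assume v: "v \<in> carrier_vec n"
  define u where "u = vec m (\<lambda>j. if j < n \<and> j \<in> A then v $ j else 0)"
  have u: "u \<in> carrier_vec m" by (simp add: u_def)
  have "vec_norm u = L2_set (\<lambda>i. cmod (u $ i)) {..<n}"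
    unfolding vec_norm_def L2_set_def
    by (intro arg_cong[where f = sqrt] sum.mono_neutral_cong_right) (use nm in \<open>auto simp: u_def\<close>)
  also have "\<dots> \<le> vec_norm v"
    unfolding vec_norm_def carrier_vecD[OF v] using nm by (intro L2_set_mono) (auto simp: u_def)
  finally have uv: "vec_norm u \<le> vec_norm v" .
  have "(S *\<^sub>v v) $ i = (if i \<in> A then c * (M *\<^sub>v u) $ i else 0)" if i: "i < n" for i
  proof -
    have "(M *\<^sub>v u) $ i = (\<Sum>j<m. M $$ (i, j) * u $ j)"
      using i nm M u by (auto simp: scalar_prod_def lessThan_atLeast0)
    also have "\<dots> = (\<Sum>j<n. if j \<in> A then M $$ (i, j) * v $ j else 0)"
      by (intro sum.mono_neutral_cong_right) (use nm in \<open>auto simp: u_def\<close>)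
    finally have Mu: "(M *\<^sub>v u) $ i = (\<Sum>j<n. if j \<in> A then M $$ (i, j) * v $ j else 0)" .
    have "(S *\<^sub>v v) $ i = (\<Sum>j<n. S $$ (i, j) * v $ j)"
      using i S v by (auto simp: scalar_prod_def lessThan_atLeast0)
    then show ?thesis
      using i by (auto simp: Mu ent sum_distrib_left intro!: sum.cong)
  qed
  then have "vec_norm (S *\<^sub>v v) \<le> cmod c * vec_norm (M *\<^sub>v u)"
    using S M nm by (intro vec_norm_le_entries) (auto simp: norm_mult)
  also have "\<dots> \<le> cmod c * (op_norm M * vec_norm v)"
    using vec_norm_mult_le[OF M u] uv op_norm_nonneg[of M]
    by (intro mult_left_mono) (auto intro: order_trans mult_left_mono)
  finally show "vec_norm (S *\<^sub>v v) \<le> cmod c * op_norm M * vec_norm v" by simp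
qed (simp add: op_norm_nonneg)

corollary op_norm_smult_le:
  assumes "T \<in> carrier_mat n n"
  shows "op_norm (c \<cdot>\<^sub>m T) \<le> cmod c * op_norm T"
  by (rule op_norm_corner_le[where A = UNIV and n = n and m = n]) (use assms in auto)


lemma contraction_vec_norm:
  assumes "X \<in> carrier_mat n n" "op_norm X \<le> 1" "v \<in> carrier_vec n"
  shows "vec_norm (X *\<^sub>v v) \<le> vec_norm v"
  using vec_norm_mult_le[OF assms(1,3)] mult_right_mono[OF assms(2) vec_norm_nonneg[of v]] by linarith

lemma diag_part_carrier [simp]: "T \<in> carrier_mat m n \<Longrightarrow> diag_part T \<in> carrier_mat m n"
  by (auto simp: diag_part_def)

lemma op_norm_off_diagonal:
  assumes M: "M \<in> carrier_mat n n" and c: "op_norm M \<le> 1"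
  shows "op_norm (M - diag_part M) \<le> 2"
proof -
  have "M - diag_part M = M + (- 1) \<cdot>\<^sub>m diag_part M"
    using M by (intro eq_matI) (auto simp: diag_part_def)
  then have "op_norm (M - diag_part M) \<le> op_norm M + op_norm ((- 1) \<cdot>\<^sub>m diag_part M)"
    using op_norm_add[of M n n "(- 1) \<cdot>\<^sub>m diag_part M"] M by simp
  also have "\<dots> \<le> 1 + 1"
    using op_norm_smult_le[of "diag_part M" n "- 1"] op_norm_diag_part[OF M] M c by simp
  finally show ?thesis by simp
qed

lemma unitary_contraction:
  assumes U: "U \<in> carrier_mat n n" and un: "U \<in> unitary_ops"
  shows "op_norm U \<le> 1"
proof (rule op_norm_leI[OF U])
  fix v :: "complex vec" assume v: "v \<in> carrier_vec n"
  have Uv: "U *\<^sub>v v \<in> carrier_vec n" using U v by auto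
  have "mat_adjoint U * U = 1\<^sub>m n"
    using U un by (auto simp: unitary_ops_def inverts_mat_def)
  then have "mat_adjoint U *\<^sub>v (U *\<^sub>v v) = v"
    using assoc_mult_mat_vec[OF mat_adjoint_carrier[OF U] U v] v by simp
  then have "(U *\<^sub>v v) \<bullet>c (U *\<^sub>v v) = v \<bullet>c v"
    using inner_adjoint[OF U v Uv] by simp
  then have "(vec_norm (U *\<^sub>v v))\<^sup>2 = (vec_norm v)\<^sup>2"
    unfolding inner_self of_real_eq_iff .
  then show "vec_norm (U *\<^sub>v v) \<le> 1 * vec_norm v"
    using power2_eq_imp_eq[OF _ vec_norm_nonneg[of "U *\<^sub>v v"] vec_norm_nonneg[of v]] by simp
qed simp

lemma projection_contraction:
  assumes P: "P \<in> carrier_mat n n" and pr: "P \<in> orthogonal_projections"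
  shows "op_norm P \<le> 1"
proof (rule op_norm_leI[OF P])
  fix v :: "complex vec" assume v: "v \<in> carrier_vec n"
  let ?w = "P *\<^sub>v v"
  have w: "?w \<in> carrier_vec n" using P v by auto
  have "P *\<^sub>v ?w = ?w"
    using assoc_mult_mat_vec[OF P P v] pr by (simp add: orthogonal_projections_def)
  then have "?w \<bullet>c ?w = v \<bullet>c ?w"
    using inner_adjoint[OF P v w] pr by (simp add: orthogonal_projections_def)
  then have "(vec_norm ?w)\<^sup>2 = cmod (v \<bullet>c ?w)"
    using inner_self[of ?w] by (metis abs_of_nonneg norm_of_real zero_le_power2)
  also have "\<dots> \<le> vec_norm v * vec_norm ?w"
    by (rule cauchy_schwarz) (simp only: carrier_vecD[OF v] carrier_vecD[OF w])
  finally have "vec_norm ?w * vec_norm ?w \<le> vec_norm v * vec_norm ?w"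
    by (simp add: power2_eq_square)
  then show "vec_norm ?w \<le> 1 * vec_norm v"
    using vec_norm_nonneg[of ?w] vec_norm_nonneg[of v]
    by (metis mult_1 mult_le_cancel_right_pos order_le_less)
qed simp

lemma Re_inner_contraction:
  assumes S: "S \<in> carrier_mat n n" and c: "op_norm S \<le> 1" and v: "v \<in> carrier_vec n"
  shows "\<bar>Re ((S *\<^sub>v v) \<bullet>c v)\<bar> \<le> (vec_norm v)\<^sup>2"
proof -
  have "\<bar>Re ((S *\<^sub>v v) \<bullet>c v)\<bar> \<le> vec_norm (S *\<^sub>v v) * vec_norm v"
    using cauchy_schwarz[of "S *\<^sub>v v" v] S v abs_Re_le_cmod order_trans by fastforce
  also have "\<dots> \<le> (1 * vec_norm v) * vec_norm v"
    using vec_norm_mult_le[OF S v] mult_right_mono[OF c vec_norm_nonneg[of v]]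
    by (intro mult_right_mono vec_norm_nonneg) linarith
  finally show ?thesis by (simp add: power2_eq_square)
qed

section \<open>Positive semidefinite matrices are Gram matrices\<close>

text \<open>
  The value \<open>\<langle>F x, x\<rangle>\<close> for the matrix \<open>F\<close> with entries \<open>f i j\<close>, \<open>i, j < n\<close>. Entry functions rather than
  matrices, because the decomposition below is by induction on the size.
\<close>

definition quad_form :: "nat \<Rightarrow> (nat \<Rightarrow> nat \<Rightarrow> complex) \<Rightarrow> (nat \<Rightarrow> complex) \<Rightarrow> complex" where
  "quad_form n f x = (\<Sum>i<n. \<Sum>j<n. f i j * x j * cnj (x i))"

lemma quad_form_Suc:
  assumes herm: "\<forall>i<n. f i n = cnj (f n i)"
  shows "quad_form (Suc n) f x = quad_form n f x + x n * cnj (\<Sum>j<n. f n j * x j)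
    + cnj (x n) * (\<Sum>j<n. f n j * x j) + f n n * x n * cnj (x n)"
  by (simp add: quad_form_def herm sum.distrib sum_distrib_left sum_distrib_right algebra_simps)

text \<open>
  On a vector with entry \<open>1\<close> at \<open>i\<close> and \<open>- s * f n i\<close> at \<open>n\<close> the form takes the value
  \<open>f i i - 2 * s * \<bar>f n i\<bar>\<^sup>2\<close>, which becomes negative for large \<open>s\<close> unless \<open>f n i = 0\<close>.
\<close>

lemma psd_zero_pivot:
  assumes herm: "\<forall>i<n. f i n = cnj (f n i)"
    and psd: "\<And>x. 0 \<le> Re (quad_form (Suc n) f x)"
    and pivot: "f n n = 0" and i: "i < n"
  shows "f n i = 0"
proof (rule ccontr)
  assume nz: "f n i \<noteq> 0"
  \<comment> \<open>This choice makes the value of the form equal to \<open>-1\<close>.\<close>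
  define s where "s = (Re (f i i) + 1) / (2 * (cmod (f n i))\<^sup>2)"
  define x where "x = (\<lambda>k. if k = i then 1 else if k = n then - of_real s * f n i else 0)"
  have q: "quad_form n f x = f i i"
  proof -
    have "quad_form n f x = (\<Sum>k<n. if k = i then \<Sum>j<n. if j = i then f i i else 0 else 0)"
      unfolding quad_form_def
    proof (intro sum.cong refl)
      fix k assume "k \<in> {..<n}"
      moreover have "(\<Sum>j<n. f i j * x j) = (\<Sum>j<n. if j = i then f i i else 0)"
        by (intro sum.cong refl) (auto simp: x_def)
      ultimately show "(\<Sum>j<n. f k j * x j * cnj (x k)) =
          (if k = i then \<Sum>j<n. if j = i then f i i else 0 else 0)"
        by (auto simp: x_def)
    qed
    then show ?thesis using i by simp
  qed
  have b: "(\<Sum>j<n. f n j * x j) = f n i"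
  proof -
    have "(\<Sum>j<n. f n j * x j) = (\<Sum>j<n. if j = i then f n i else 0)"
      by (intro sum.cong refl) (auto simp: x_def)
    then show ?thesis using i by simp
  qed
  have "x n = - of_real s * f n i" using i by (simp add: x_def)
  then have "quad_form (Suc n) f x = f i i - of_real (2 * s * (cmod (f n i))\<^sup>2)"
    unfolding quad_form_Suc[of n f x, OF herm] b q pivot
    by (simp add: complex_norm_square[symmetric] mult.assoc
        complex_norm_square[of "f n i"] algebra_simps)
  then have "Re (quad_form (Suc n) f x) = Re (f i i) - 2 * s * (cmod (f n i))\<^sup>2"
    by simp
  also have "2 * s * (cmod (f n i))\<^sup>2 = Re (f i i) + 1"
    using nz by (simp add: s_def field_simps)
  finally have "Re (quad_form (Suc n) f x) = - 1" by simp
  with psd[of x] show False by simp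
qed

text \<open>
  Cholesky decomposition by splitting off the last index. The Schur complement \<open>h\<close> of the pivot
  \<open>a = f n n\<close> is again positive semidefinite, because its form at \<open>x\<close> is the form of \<open>f\<close> at the
  extension of \<open>x\<close> that minimizes it. A factor of \<open>h\<close> is then completed by the last column of \<open>f\<close>
  divided by \<open>sqrt a\<close>. If \<open>a = 0\<close>, that column vanishes, and division by zero giving zero makes the
  same formulas correct.
\<close>

lemma cholesky_fun:
  assumes "\<And>i j. i < n \<Longrightarrow> j < n \<Longrightarrow> f i j = cnj (f j i)"
    and "\<And>x. 0 \<le> Re (quad_form n f x)"
  shows "\<exists>g. \<forall>i<n. \<forall>j<n. f i j = (\<Sum>k<n. g i k * cnj (g j k))"
  using assms
proof (induction n arbitrary: f)
  case 0
  show ?case by simp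
next
  case (Suc n)
  note herm = Suc.prems(1) and psd = Suc.prems(2)
  define a where "a = Re (f n n)"
  have a: "f n n = of_real a"
    using herm[of n n] by (simp add: a_def complex_eq_iff)
  have hn: "\<forall>i<n. f i n = cnj (f n i)"
    using herm[of _ n] by simp
  have "quad_form n f (\<lambda>k. if k = n then 1 else 0) = 0"
    by (auto simp: quad_form_def intro!: sum.neutral)
  then have a0: "0 \<le> a"
    using psd[of "\<lambda>k. if k = n then 1 else 0"] quad_form_Suc[of n f, OF hn] by (simp add: a_def)
  have pivot: "f n i = 0" if "a = 0" "i < n" for i
    using psd_zero_pivot[of n f i] hn psd a that by simp
  define h where "h i j = f i j - cnj (f n i) * f n j / of_real a" for i j
  have "0 \<le> Re (quad_form n h x)" for x
  proof -
    define b where "b = (\<Sum>j<n. f n j * x j)"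
    \<comment> \<open>The last entry completes the square in the form of \<open>f\<close>.\<close>
    define y where "y = x(n := - b / of_real a)"
    have q: "quad_form n h x = quad_form n f x - cnj b * b / of_real a"
    proof -
      have "cnj b * b / of_real a =
          (\<Sum>i<n. \<Sum>j<n. cnj (f n i) * f n j / of_real a * x j * cnj (x i))"
        unfolding b_def cnj_sum sum_product sum_divide_distrib by (intro sum.cong refl) (simp add: mult_ac)
      then show ?thesis
        by (simp add: quad_form_def h_def sum_subtractf[symmetric] left_diff_distrib)
    qed
    have yx: "quad_form n f y = quad_form n f x" "(\<Sum>j<n. f n j * y j) = b" "y n = - b / of_real a"
      by (auto simp: y_def b_def quad_form_def intro!: sum.cong)
    have "quad_form (Suc n) f y = quad_form n h x"
      unfolding quad_form_Suc[of n f y, OF hn] yx q a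
      by (cases "a = 0") (auto simp: field_simps)
    then show ?thesis using psd[of y] by simp
  qed
  moreover have "h i j = cnj (h j i)" if "i < n" "j < n" for i j
    using that herm[of i j] by (simp add: h_def)
  ultimately obtain g where g: "\<And>i j. i < n \<Longrightarrow> j < n \<Longrightarrow> h i j = (\<Sum>k<n. g i k * cnj (g j k))"
    using Suc.IH[of h] by blast
  define g' where "g' i k = (if k < n then if i < n then g i k else 0
      else if i < n then cnj (f n i) / of_real (sqrt a) else of_real (sqrt a))" for i k
  have sq: "complex_of_real (sqrt a) * of_real (sqrt a) = of_real a"
    using a0 by (simp flip: of_real_mult)
  have "f i j = (\<Sum>k<Suc n. g' i k * cnj (g' j k))" if ij: "i < Suc n" "j < Suc n" for i j
  proof -
    consider "i < n" "j < n" | "i < n" "j = n" | "i = n" "j < n" | "i = n" "j = n"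
      using ij by linarith
    then show ?thesis
    proof cases
      case 1
      have "(\<Sum>k<Suc n. g' i k * cnj (g' j k)) = h i j + cnj (f n i) * f n j / of_real a"
        using 1 by (simp add: g'_def g sq)
      then show ?thesis by (simp add: h_def)
    next
      case 2
      then show ?thesis using pivot[of i] a0 hn by (auto simp: g'_def)
    next
      case 3
      then show ?thesis using pivot[of j] a0 by (auto simp: g'_def)
    next
      case 4
      then show ?thesis by (simp add: g'_def sq a)
    qed
  qed
  then show ?case by blast
qed

lemma psd_factorization:
  fixes M :: "complex mat"
  assumes M: "M \<in> carrier_mat n n" and herm: "mat_adjoint M = M"
    and psd: "\<And>v. v \<in> carrier_vec n \<Longrightarrow> 0 \<le> Re ((M *\<^sub>v v) \<bullet>c v)"
  obtains X where "X \<in> carrier_mat n n" "X * mat_adjoint X = M"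
proof -
  have "\<exists>g. \<forall>i<n. \<forall>j<n. M $$ (i, j) = (\<Sum>k<n. g i k * cnj (g j k))"
  proof (rule cholesky_fun)
    show "M $$ (i, j) = cnj (M $$ (j, i))" if "i < n" "j < n" for i j
      using that M index_mat_adjoint[of i M j] herm by simp
    fix x
    have "(M *\<^sub>v vec n x) \<bullet>c vec n x = quad_form n (\<lambda>i j. M $$ (i, j)) x"
      using M by (auto simp: quad_form_def scalar_prod_def lessThan_atLeast0 sum_distrib_right
          intro!: sum.cong)
    with psd[of "vec n x"] show "0 \<le> Re (quad_form n (\<lambda>i j. M $$ (i, j)) x)" by simp
  qed
  then obtain g where g: "\<And>i j. i < n \<Longrightarrow> j < n \<Longrightarrow> M $$ (i, j) = (\<Sum>k<n. g i k * cnj (g j k))"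
    by blast
  show thesis
  proof (rule that)
    show "mat n n (\<lambda>(i, j). g i j) * mat_adjoint (mat n n (\<lambda>(i, j). g i j)) = M"
      using M by (intro eq_matI) (auto simp: g scalar_prod_def lessThan_atLeast0)
  qed simp
qed

section \<open>Dilating a self-adjoint contraction\<close>

text \<open>
  The vectors are the rows of a factor \<open>X\<close> with \<open>X X\<^sup>* = 1 + S\<close>, so the operator mapping the basis to them
  is the transpose of \<open>X\<close>; they have unit length because \<open>S\<close> has zero diagonal.
\<close>

lemma gram_dilation:
  assumes S: "S \<in> carrier_mat n n" and herm: "mat_adjoint S = S" and zd: "zero_diagonal S"
    and c: "op_norm S \<le> 1"
  shows "1\<^sub>m n + S \<in> unit_gram_matrices"
proof -
  have "\<exists>X\<in>carrier_mat n n. X * mat_adjoint X = 1\<^sub>m n + S"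
  proof (rule psd_factorization[of "1\<^sub>m n + S" n])
    show "1\<^sub>m n + S \<in> carrier_mat n n" using S by simp
    show "mat_adjoint (1\<^sub>m n + S) = 1\<^sub>m n + S"
      using S herm by (simp add: mat_adjoint_add[where m = n and n = n])
    show "0 \<le> Re (((1\<^sub>m n + S) *\<^sub>v v) \<bullet>c v)" if v: "v \<in> carrier_vec n" for v
    proof -
      have "((1\<^sub>m n + S) *\<^sub>v v) \<bullet>c v = of_real ((vec_norm v)\<^sup>2) + (S *\<^sub>v v) \<bullet>c v"
        using S v inner_self[of v]
        by (simp add: add_mult_distrib_mat_vec[where nr = n and nc = n] inner_add_left[where n = n])
      then show ?thesis using Re_inner_contraction[OF S c v] by simp
    qed
  qed blast
  then obtain X where X: "X \<in> carrier_mat n n" and XX: "X * mat_adjoint X = 1\<^sub>m n + S" by blast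
  have ent: "(1\<^sub>m n + S) $$ (i, j) = (\<Sum>k<n. X $$ (i, k) * cnj (X $$ (j, k)))"
    if "i < n" "j < n" for i j
    using X that unfolding XX[symmetric] by (simp add: scalar_prod_def lessThan_atLeast0)
  define f where "f i = row X i" for i
  have T: "X\<^sup>T *\<^sub>v unit_vec n i = f i" if "i < n" for i
    using X that by (intro eq_vecI) (auto simp: f_def)
  have "vec_norm (f i) = 1" if i: "i < n" for i
  proof -
    have "complex_of_real ((vec_norm (f i))\<^sup>2) = (1\<^sub>m n + S) $$ (i, i)"
      using X i unfolding inner_self[symmetric] ent[OF i i]
      by (auto simp: f_def scalar_prod_def lessThan_atLeast0)
    also have "\<dots> = 1" using S zd i by (auto simp: zero_diagonal_def)
    finally have "(vec_norm (f i))\<^sup>2 = 1" using of_real_eq_1_iff by blast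
    then show ?thesis using vec_norm_nonneg[of "f i"] by (simp add: power2_eq_1_iff)
  qed
  moreover have "1\<^sub>m n + S = gram_matrix n f"
  proof (rule eq_matI)
    fix i j assume "i < dim_row (gram_matrix n f)" "j < dim_col (gram_matrix n f)"
    then have ij: "i < n" "j < n" by (auto simp: gram_matrix_def)
    show "(1\<^sub>m n + S) $$ (i, j) = gram_matrix n f $$ (i, j)"
      using X ij unfolding ent[OF ij] by (simp add: gram_matrix_def f_def scalar_prod_def lessThan_atLeast0)
  qed (use S in \<open>auto simp: gram_matrix_def\<close>)
  ultimately show ?thesis
    unfolding unit_gram_matrices_def mem_Collect_eq
    using T X by (intro exI[of _ n] exI[of _ f] conjI bexI[of _ "X\<^sup>T"]) simp_all
qed

text \<open>
  Naimark-type dilation of \<open>0 \<le> A \<le> 1\<close>. With \<open>A = X X\<^sup>*\<close> the adjoint of \<open>X\<close> is a contraction, hence so is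
  \<open>X\<close>, and \<open>1 - X\<^sup>* X\<close> has a factorization \<open>Z Z\<^sup>*\<close> too. Stacking \<open>X\<close> on \<open>Z\<^sup>*\<close> gives \<open>V\<close> with
  \<open>V\<^sup>* V = X\<^sup>* X + Z Z\<^sup>* = 1\<close>, so \<open>V V\<^sup>*\<close> is a projection, with upper left corner \<open>X X\<^sup>* = A\<close>.
\<close>

lemma projection_dilation:
  fixes A :: "complex mat"
  assumes A: "A \<in> carrier_mat n n" and herm: "mat_adjoint A = A"
    and ge0: "\<And>v. v \<in> carrier_vec n \<Longrightarrow> 0 \<le> Re ((A *\<^sub>v v) \<bullet>c v)"
    and le1: "\<And>v. v \<in> carrier_vec n \<Longrightarrow> Re ((A *\<^sub>v v) \<bullet>c v) \<le> (vec_norm v)\<^sup>2"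
  obtains P where "P \<in> carrier_mat (n + n) (n + n)" "P \<in> orthogonal_projections"
    "\<And>i j. i < n \<Longrightarrow> j < n \<Longrightarrow> P $$ (i, j) = A $$ (i, j)"
proof -
  obtain X where X: "X \<in> carrier_mat n n" and XX: "X * mat_adjoint X = A"
    using psd_factorization[OF A herm ge0] by blast
  note X' = mat_adjoint_carrier[OF X]
  have "op_norm (mat_adjoint X) \<le> 1"
  proof (rule op_norm_leI[OF X'])
    fix v :: "complex vec" assume v: "v \<in> carrier_vec n"
    have "(A *\<^sub>v v) \<bullet>c v = (mat_adjoint X *\<^sub>v v) \<bullet>c (mat_adjoint X *\<^sub>v v)"
      using inner_adjoint[OF X mult_mat_vec_carrier[OF X' v] v] X X' v
      by (simp flip: XX add: assoc_mult_mat_vec[where n\<^sub>1 = n and n\<^sub>2 = n and n\<^sub>3 = n])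
    then have "(vec_norm (mat_adjoint X *\<^sub>v v))\<^sup>2 \<le> (vec_norm v)\<^sup>2"
      using le1[OF v] by (simp add: inner_self)
    then show "vec_norm (mat_adjoint X *\<^sub>v v) \<le> 1 * vec_norm v"
      using power2_le_imp_le[OF _ vec_norm_nonneg] by simp
  qed simp
  then have cX: "op_norm X \<le> 1"
    using op_norm_adjoint[OF X'] by simp
  let ?C = "1\<^sub>m n + (- 1) \<cdot>\<^sub>m (mat_adjoint X * X)"
  have XX': "mat_adjoint X * X \<in> carrier_mat n n" using X X' by (rule mult_carrier_mat[rotated])
  have "\<exists>Z\<in>carrier_mat n n. Z * mat_adjoint Z = ?C"
  proof (rule psd_factorization[of ?C n])
    show "?C \<in> carrier_mat n n" using XX' by simp
    show "mat_adjoint ?C = ?C"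
      using XX' mat_adjoint_mult[OF X' X]
      by (simp add: mat_adjoint_add[where m = n and n = n] mat_adjoint_smult)
    fix v :: "complex vec" assume v: "v \<in> carrier_vec n"
    let ?w = "X *\<^sub>v v"
    have w: "?w \<in> carrier_vec n" using X v by auto
    have "?C *\<^sub>v v = 1\<^sub>m n *\<^sub>v v + ((- 1) \<cdot>\<^sub>m (mat_adjoint X * X)) *\<^sub>v v"
      by (rule add_mult_distrib_mat_vec[of _ n n]) (use XX' v in auto)
    also have "\<dots> = v + (- 1) \<cdot>\<^sub>v (mat_adjoint X *\<^sub>v ?w)"
      unfolding smult_mat_mult_vec[OF XX' v] assoc_mult_mat_vec[OF X' X v] using v by simp
    finally have "(?C *\<^sub>v v) \<bullet>c v = v \<bullet>c v - (mat_adjoint X *\<^sub>v ?w) \<bullet>c v"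
      using mult_mat_vec_carrier[OF X' w] v by (simp add: inner_add_left[where n = n])
    also have "(mat_adjoint X *\<^sub>v ?w) \<bullet>c v = ?w \<bullet>c ?w"
      using inner_adjoint[OF X' w v] by simp
    finally have "Re ((?C *\<^sub>v v) \<bullet>c v) = (vec_norm v)\<^sup>2 - (vec_norm ?w)\<^sup>2"
      by (simp add: inner_self)
    moreover have "(vec_norm ?w)\<^sup>2 \<le> (vec_norm v)\<^sup>2"
      by (intro power_mono contraction_vec_norm[OF X cX v] vec_norm_nonneg)
    ultimately show "0 \<le> Re ((?C *\<^sub>v v) \<bullet>c v)" by simp
  qed blast
  then obtain Z where Z: "Z \<in> carrier_mat n n" and ZZ: "Z * mat_adjoint Z = ?C" by blast
  define V where "V = mat (n + n) n (\<lambda>(i, j). if i < n then X $$ (i, j) else cnj (Z $$ (j, i - n)))"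
  have V: "V \<in> carrier_mat (n + n) n" by (simp add: V_def)
  note V' = mat_adjoint_carrier[OF V]
  have isom: "mat_adjoint V * V = 1\<^sub>m n"
  proof (rule eq_matI)
    fix i j assume "i < dim_row (1\<^sub>m n)" "j < dim_col (1\<^sub>m n)"
    then have ij: "i < n" "j < n" by auto
    have "(mat_adjoint V * V) $$ (i, j) = (\<Sum>k<n + n. cnj (V $$ (k, i)) * V $$ (k, j))"
      using V ij by (simp add: scalar_prod_def lessThan_atLeast0)
    also have "\<dots> = (\<Sum>k<n. cnj (X $$ (k, i)) * X $$ (k, j)) + (\<Sum>k<n. Z $$ (i, k) * cnj (Z $$ (j, k)))"
      using ij by (simp add: sum_lessThan_add V_def)
    also have "\<dots> = (mat_adjoint X * X) $$ (i, j) + (Z * mat_adjoint Z) $$ (i, j)"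
      using X Z ij by (simp add: scalar_prod_def lessThan_atLeast0)
    also have "\<dots> = 1\<^sub>m n $$ (i, j)"
      using X ij by (simp add: ZZ del: index_mult_mat(1))
    finally show "(mat_adjoint V * V) $$ (i, j) = 1\<^sub>m n $$ (i, j)" .
  qed (use V in auto)
  let ?P = "V * mat_adjoint V"
  show thesis
  proof (rule that[of ?P])
    show "?P \<in> carrier_mat (n + n) (n + n)" using V by auto
    have "?P * ?P = V * (mat_adjoint V * (V * mat_adjoint V))"
      using V V' by (intro assoc_mult_mat) auto
    also have "mat_adjoint V * (V * mat_adjoint V) = (mat_adjoint V * V) * mat_adjoint V"
      using V V' by (intro assoc_mult_mat[symmetric]) auto
    finally have "?P * ?P = ?P" by (simp only: isom left_mult_one_mat[OF V'])
    then show "?P \<in> orthogonal_projections"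
      using V by (simp add: orthogonal_projections_def mat_adjoint_mult[OF V V'])
    show "?P $$ (i, j) = A $$ (i, j)" if "i < n" "j < n" for i j
      using V X that unfolding XX[symmetric] by (simp add: scalar_prod_def) (simp add: V_def)
  qed
qed


text \<open>
  \<open>A = (1 + S) / 2\<close> lies between \<open>0\<close> and \<open>1\<close> since \<open>\<bar>\<langle>S v, v\<rangle>\<bar> \<le> \<parallel>v\<parallel>\<^sup>2\<close>.
\<close>

lemma half_shift_projection:
  assumes S: "S \<in> carrier_mat n n" and herm: "mat_adjoint S = S" and c: "op_norm S \<le> 1"
  obtains P where "P \<in> carrier_mat (n + n) (n + n)" "P \<in> orthogonal_projections"
    "\<And>i j. i < n \<Longrightarrow> j < n \<Longrightarrow> i \<noteq> j \<Longrightarrow> S $$ (i, j) = 2 * P $$ (i, j)"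
proof -
  let ?A = "(1 / 2) \<cdot>\<^sub>m (1\<^sub>m n + S)"
  have A: "?A \<in> carrier_mat n n" using S by simp
  have hA: "mat_adjoint ?A = ?A"
    using S herm by (simp add: mat_adjoint_smult mat_adjoint_add[where m = n and n = n])
  have q: "Re ((?A *\<^sub>v v) \<bullet>c v) = ((vec_norm v)\<^sup>2 + Re ((S *\<^sub>v v) \<bullet>c v)) / 2"
    if v: "v \<in> carrier_vec n" for v
  proof -
    have Sv: "S *\<^sub>v v \<in> carrier_vec n" using S v by auto
    have "?A *\<^sub>v v = (1 / 2) \<cdot>\<^sub>v (v + S *\<^sub>v v)"
      using S v by (simp add: smult_mat_mult_vec[where m = n and n = n]
          add_mult_distrib_mat_vec[where nr = n and nc = n])
    then have "(?A *\<^sub>v v) \<bullet>c v = (1 / 2) * ((v + S *\<^sub>v v) \<bullet>c v)"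
      using Sv v by (simp add: smult_scalar_prod_distrib[where n = n])
    also have "(v + S *\<^sub>v v) \<bullet>c v = v \<bullet>c v + (S *\<^sub>v v) \<bullet>c v"
      by (rule inner_add_left[OF v Sv v])
    finally have "(?A *\<^sub>v v) \<bullet>c v = (1 / 2) * (v \<bullet>c v + (S *\<^sub>v v) \<bullet>c v)" .
    then show ?thesis by (simp only: inner_self) simp
  qed
  have bound: "\<bar>Re ((S *\<^sub>v v) \<bullet>c v)\<bar> \<le> (vec_norm v)\<^sup>2" if "v \<in> carrier_vec n" for v
    by (rule Re_inner_contraction[OF S c that])
  obtain P where "P \<in> carrier_mat (n + n) (n + n)" "P \<in> orthogonal_projections"
    and PA: "\<And>i j. i < n \<Longrightarrow> j < n \<Longrightarrow> P $$ (i, j) = ?A $$ (i, j)"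
  proof (rule projection_dilation[OF A hA])
    fix v :: "complex vec" assume "v \<in> carrier_vec n"
    from q[OF this] bound[OF this]
    show "0 \<le> Re ((?A *\<^sub>v v) \<bullet>c v)" "Re ((?A *\<^sub>v v) \<bullet>c v) \<le> (vec_norm v)\<^sup>2"
      by (auto simp: abs_le_iff)
  qed blast
  moreover have "S $$ (i, j) = 2 * P $$ (i, j)" if "i < n" "j < n" "i \<noteq> j" for i j
    using S that by (simp add: PA)
  ultimately show thesis using that by blast
qed

lemma projection_reflection_unitary:
  assumes P: "P \<in> carrier_mat n n" and pr: "P \<in> orthogonal_projections"
  shows "2 \<cdot>\<^sub>m P + (- 1) \<cdot>\<^sub>m 1\<^sub>m n \<in> unitary_ops"
proof -
  let ?U = "2 \<cdot>\<^sub>m P + (- 1) \<cdot>\<^sub>m 1\<^sub>m n"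
  have PP: "P * P = P" "mat_adjoint P = P" using pr by (auto simp: orthogonal_projections_def)
  have "?U * ?U = (2 \<cdot>\<^sub>m P) * ?U + ((- 1) \<cdot>\<^sub>m 1\<^sub>m n) * ?U"
    using P by (intro add_mult_distrib_mat) auto
  also have "(2 \<cdot>\<^sub>m P) * ?U = (2 \<cdot>\<^sub>m P) * (2 \<cdot>\<^sub>m P) + (2 \<cdot>\<^sub>m P) * ((- 1) \<cdot>\<^sub>m 1\<^sub>m n)"
    using P by (intro mult_add_distrib_mat) auto
  also have "(2 \<cdot>\<^sub>m P) * (2 \<cdot>\<^sub>m P) = 4 \<cdot>\<^sub>m P"
    using P PP by (simp add: mult_smult_assoc_mat[where nr = n and n = n and nc = n]
        mult_smult_distrib[where nr = n and n = n and nc = n])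
      (intro eq_matI; simp)
  also have "(2 \<cdot>\<^sub>m P) * ((- 1) \<cdot>\<^sub>m 1\<^sub>m n) = (- 2) \<cdot>\<^sub>m P"
    using P by (simp add: mult_smult_assoc_mat[where nr = n and n = n and nc = n]
        mult_smult_distrib[where nr = n and n = n and nc = n])
      (intro eq_matI; simp)
  also have "((- 1) \<cdot>\<^sub>m 1\<^sub>m n) * ?U = (- 1) \<cdot>\<^sub>m ?U"
    using P by (simp add: mult_smult_assoc_mat[where nr = n and n = n and nc = n])
  also have "4 \<cdot>\<^sub>m P + (- 2) \<cdot>\<^sub>m P + (- 1) \<cdot>\<^sub>m ?U = 1\<^sub>m n"
    using P by (intro eq_matI) auto
  finally have "?U * ?U = 1\<^sub>m n" .
  moreover have "mat_adjoint ?U = ?U"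
    using P PP by (simp add: mat_adjoint_add[where m = n and n = n] mat_adjoint_smult)
  ultimately show ?thesis
    using P by (simp add: unitary_ops_def inverts_mat_def)
qed

text \<open>
  The inverse is the block matrix with rows \<open>(0, 1)\<close> and \<open>(1, -S)\<close>. The norm bound \<open>3\<close> comes from the
  three nonzero blocks, each of norm at most \<open>1\<close>.
\<close>

lemma invertible_zero_diagonal_dilation:
  assumes S: "S \<in> carrier_mat n n" and zd: "zero_diagonal S" and c: "op_norm S \<le> 1"
  defines "M \<equiv> four_block_mat S (1\<^sub>m n) (1\<^sub>m n) (0\<^sub>m n n)"
  shows "M \<in> invertible_zero_diagonal_ops" "op_norm (M - diag_part M) \<le> 3"
proof -
  have M: "M \<in> carrier_mat (n + n) (n + n)" using S by (simp add: M_def)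
  let ?N = "four_block_mat (0\<^sub>m n n) (1\<^sub>m n) (1\<^sub>m n) ((- 1) \<cdot>\<^sub>m S)"
  have cancel: "S + (- 1) \<cdot>\<^sub>m S = 0\<^sub>m n n" "(- 1) \<cdot>\<^sub>m S + S = 0\<^sub>m n n"
    using S by (auto intro!: eq_matI)
  have "M * ?N = 1\<^sub>m (n + n)" "?N * M = 1\<^sub>m (n + n)"
    unfolding M_def using S
    by (simp_all add: mult_four_block_mat[where ?nr1.0 = n and ?nr2.0 = n and ?n1.0 = n and ?n2.0 = n
          and ?nc1.0 = n and ?nc2.0 = n] cancel)
  then have "invertible_mat M"
    using M S unfolding invertible_mat_def inverts_mat_def by (auto intro!: exI[of _ ?N])
  moreover have zM: "zero_diagonal M"
    using S zd by (auto simp: zero_diagonal_def M_def)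
  ultimately show "M \<in> invertible_zero_diagonal_ops"
    by (simp add: invertible_zero_diagonal_ops_def)
  have "M - diag_part M = M"
    using M zM by (intro eq_matI) (auto simp: diag_part_def zero_diagonal_def)
  moreover have "op_norm M \<le> 3"
  proof (rule op_norm_leI[OF M])
    fix v :: "complex vec" assume v: "v \<in> carrier_vec (n + n)"
    define a b where "a = vec_first v n" and "b = vec_last v n"
    have ab: "a \<in> carrier_vec n" "b \<in> carrier_vec n" "v = a @\<^sub>v b"
      using v by (auto simp: a_def b_def)
    have Sa: "S *\<^sub>v a \<in> carrier_vec n" using S ab by auto
    have le: "vec_norm a \<le> vec_norm v" "vec_norm b \<le> vec_norm v"
    proof -
      show "vec_norm a \<le> vec_norm v"
        using vec_norm_le_entries[of a v 1] ab by simp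
      show "vec_norm b \<le> vec_norm v"
        using ab by (simp add: vec_norm_def L2_set_def sum_lessThan_add sum_nonneg)
    qed
    have "M *\<^sub>v v = (S *\<^sub>v a + b) @\<^sub>v a"
      unfolding M_def ab(3) using S ab Sa
      by (subst four_block_mat_mult_vec[where ?nr1.0 = n and ?nr2.0 = n and ?nc1.0 = n and ?nc2.0 = n]) auto
    then have "vec_norm (M *\<^sub>v v) \<le> vec_norm (S *\<^sub>v a + b) + vec_norm a"
      using vec_norm_append by simp
    also have "vec_norm (S *\<^sub>v a + b) \<le> vec_norm (S *\<^sub>v a) + vec_norm b"
      by (rule vec_norm_triangle) (simp only: carrier_vecD[OF Sa] carrier_vecD[OF ab(2)])
    also have "vec_norm (S *\<^sub>v a) \<le> vec_norm a"
      by (rule contraction_vec_norm[OF S c ab(1)])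
    finally show "vec_norm (M *\<^sub>v v) \<le> 3 * vec_norm v" using le by simp
  qed simp
  ultimately show "op_norm (M - diag_part M) \<le> 3" by simp
qed

section \<open>Transferring a paving\<close>

lemma diag_proj_carrier [simp]: "diag_proj n A \<in> carrier_mat n n"
  by (simp add: diag_proj_def)

lemma index_compression:
  assumes T: "T \<in> carrier_mat n n" and ij: "i < n" "j < n"
  shows "(diag_proj n A * T * diag_proj n A) $$ (i, j) = (if i \<in> A \<and> j \<in> A then T $$ (i, j) else 0)"
proof -
  have left: "(diag_proj n A * T) $$ (k, l) = (if k \<in> A then T $$ (k, l) else 0)"
    if "k < n" "l < n" for k l
  proof -
    have "(diag_proj n A * T) $$ (k, l) = (\<Sum>m<n. diag_proj n A $$ (k, m) * T $$ (m, l))"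
      using T that by (simp add: diag_proj_def scalar_prod_def lessThan_atLeast0)
    also have "\<dots> = (\<Sum>m<n. if m = k then if k \<in> A then T $$ (k, l) else 0 else 0)"
      using that by (intro sum.cong refl) (auto simp: diag_proj_def)
    finally show ?thesis using that by simp
  qed
  have "(diag_proj n A * T * diag_proj n A) $$ (i, j) = (\<Sum>m<n. (diag_proj n A * T) $$ (i, m) * diag_proj n A $$ (m, j))"
    using T ij by (simp add: scalar_prod_def lessThan_atLeast0 diag_proj_def)
  also have "\<dots> = (\<Sum>m<n. if m = j then if i \<in> A \<and> j \<in> A then T $$ (i, j) else 0 else 0)"
    using ij by (intro sum.cong refl) (simp add: left, simp add: diag_proj_def)
  finally show ?thesis using ij by simp
qed

lemma compression_carrier [simp]:
  "T \<in> carrier_mat n n \<Longrightarrow> diag_proj n A * T * diag_proj n A \<in> carrier_mat n n"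
  using mult_carrier_mat[OF mult_carrier_mat[OF diag_proj_carrier] diag_proj_carrier] .

lemma compression_mono:
  assumes DE: "D \<subseteq> E" and S: "S \<in> carrier_mat n n"
  shows "op_norm (diag_proj n D * S * diag_proj n D) \<le> op_norm (diag_proj n E * S * diag_proj n E)"
proof -
  have "op_norm (diag_proj n D * S * diag_proj n D)
    \<le> cmod 1 * op_norm (diag_proj n E * S * diag_proj n E)"
  proof (rule op_norm_corner_le[where A = D, OF compression_carrier[OF S] compression_carrier[OF S] order_refl])
    fix i j assume ij: "i < n" "j < n"
    show "(diag_proj n D * S * diag_proj n D) $$ (i, j) =
        (if i \<in> D \<and> j \<in> D then 1 * (diag_proj n E * S * diag_proj n E) $$ (i, j) else 0)"
      unfolding index_compression[OF S ij] using DE by auto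
  qed
  then show ?thesis by simp
qed

lemma compression_linear:
  fixes D :: "nat set"
  assumes R: "R \<in> carrier_mat n n" and J: "J \<in> carrier_mat n n"
  defines "q \<equiv> \<lambda>S. diag_proj n D * S * diag_proj n D"
  shows "q (a \<cdot>\<^sub>m (R + b \<cdot>\<^sub>m J)) = a \<cdot>\<^sub>m (q R + b \<cdot>\<^sub>m q J)"
proof (rule eq_matI)
  have T: "a \<cdot>\<^sub>m (R + b \<cdot>\<^sub>m J) \<in> carrier_mat n n" using R J by simp
  have qc: "q S \<in> carrier_mat n n" if "S \<in> carrier_mat n n" for S
    unfolding q_def using that by (rule compression_carrier)
  note qc' = qc[OF R] qc[OF J] qc[OF T]
  have ent: "q S $$ (i, j) = (if i \<in> D \<and> j \<in> D then S $$ (i, j) else 0)"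
    if "S \<in> carrier_mat n n" "i < n" "j < n" for S i j
    unfolding q_def using that by (rule index_compression)
  fix i j assume "i < dim_row (a \<cdot>\<^sub>m (q R + b \<cdot>\<^sub>m q J))" "j < dim_col (a \<cdot>\<^sub>m (q R + b \<cdot>\<^sub>m q J))"
  then have ij: "i < n" "j < n" using qc' by auto
  show "q (a \<cdot>\<^sub>m (R + b \<cdot>\<^sub>m J)) $$ (i, j) = (a \<cdot>\<^sub>m (q R + b \<cdot>\<^sub>m q J)) $$ (i, j)"
    unfolding ent[OF T ij] using qc' R J ij by (simp add: ent)
next
  show "dim_row (q (a \<cdot>\<^sub>m (R + b \<cdot>\<^sub>m J))) = dim_row (a \<cdot>\<^sub>m (q R + b \<cdot>\<^sub>m q J))"
    "dim_col (q (a \<cdot>\<^sub>m (R + b \<cdot>\<^sub>m J))) = dim_col (a \<cdot>\<^sub>m (q R + b \<cdot>\<^sub>m q J))"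
    by (simp_all add: q_def diag_proj_def)
qed

lemma index_partition_restrict:
  assumes "index_partition m r A" "n \<le> m"
  shows "index_partition n r (\<lambda>j. A j \<inter> {..<n})"
proof -
  have "(\<Union>j<r. A j \<inter> {..<n}) = (\<Union>j<r. A j) \<inter> {..<n}" by blast
  then show ?thesis
    using assms by (auto simp: index_partition_def disjoint_family_on_def)
qed

text \<open>
  The pairs of labels \<open>(p, q)\<close> with \<open>p < r\<close>, \<open>q < s\<close> are coded as \<open>p * s + q\<close>.
\<close>

lemma index_partition_refine:
  assumes A: "index_partition n r A" and B: "index_partition n s B"
  shows "index_partition n (r * s) (\<lambda>j. A (j div s) \<inter> B (j mod s))"
proof -
  have bd: "j div s < r" "j mod s < s" if "j < r * s" for j
    using that by (auto simp: less_mult_imp_div_less intro!: mod_less_divisor Nat.gr0I)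
  have "disjoint_family_on (\<lambda>j. A (j div s) \<inter> B (j mod s)) {..<r * s}"
  proof (unfold disjoint_family_on_def, intro ballI impI)
    fix j k assume "j \<in> {..<r * s}" "k \<in> {..<r * s}" and ne: "j \<noteq> k"
    then have jk: "j < r * s" "k < r * s" by auto
    have "j div s \<noteq> k div s \<or> j mod s \<noteq> k mod s"
      using ne by (metis div_mult_mod_eq)
    then show "A (j div s) \<inter> B (j mod s) \<inter> (A (k div s) \<inter> B (k mod s)) = {}"
      using A B bd[OF jk(1)] bd[OF jk(2)]
      unfolding index_partition_def disjoint_family_on_def by blast
  qed
  moreover have "(\<Union>j<r * s. A (j div s) \<inter> B (j mod s)) = {..<n}"
  proof (intro equalityI subsetI)
    fix i assume "i \<in> {..<n}"
    then have "i \<in> (\<Union>j<r. A j)" "i \<in> (\<Union>j<s. B j)" using A B by (auto simp: index_partition_def)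
    then obtain p q where pq: "p < r" "q < s" "i \<in> A p" "i \<in> B q" by blast
    have "p * s + q < p * s + s" using pq by simp
    also have "\<dots> = Suc p * s" by simp
    also have "\<dots> \<le> r * s" using pq by (intro mult_right_mono) auto
    finally show "i \<in> (\<Union>j<r * s. A (j div s) \<inter> B (j mod s))"
      using pq by (intro UN_I[of "p * s + q"]) auto
  next
    fix i assume "i \<in> (\<Union>j<r * s. A (j div s) \<inter> B (j mod s))"
    then show "i \<in> {..<n}" using A bd by (fastforce simp: index_partition_def)
  qed
  ultimately show ?thesis by (simp add: index_partition_def)
qed

lemma paving_by_dilation:
  assumes M: "M \<in> carrier_mat m m" and S: "S \<in> carrier_mat n n" and nm: "n \<le> m"
    and c: "0 \<le> c" and zd: "zero_diagonal S"
    and ent: "\<And>i j. i < n \<Longrightarrow> j < n \<Longrightarrow> i \<noteq> j \<Longrightarrow> S $$ (i, j) = complex_of_real c * M $$ (i, j)"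
  shows "op_norm (diag_proj n (A \<inter> {..<n}) * S * diag_proj n (A \<inter> {..<n}))
    \<le> c * op_norm (diag_proj m A * (M - diag_part M) * diag_proj m A)"
proof -
  have "op_norm (diag_proj n (A \<inter> {..<n}) * S * diag_proj n (A \<inter> {..<n}))
    \<le> cmod (complex_of_real c) * op_norm (diag_proj m A * (M - diag_part M) * diag_proj m A)"
  proof (rule op_norm_corner_le[where A = A, OF _ _ nm])
    show "diag_proj n (A \<inter> {..<n}) * S * diag_proj n (A \<inter> {..<n}) \<in> carrier_mat n n"
      using S by simp
    have MD: "M - diag_part M \<in> carrier_mat m m"
      using M by (simp add: minus_carrier_mat)
    then show "diag_proj m A * (M - diag_part M) * diag_proj m A \<in> carrier_mat m m"
      by simp
    fix i j assume ij: "i < n" "j < n"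
    then have ij': "i < m" "j < m" using nm by auto
    have "(M - diag_part M) $$ (i, j) = (if i = j then 0 else M $$ (i, j))"
      using M ij' by (simp add: diag_part_def)
    then show "(diag_proj n (A \<inter> {..<n}) * S * diag_proj n (A \<inter> {..<n})) $$ (i, j) =
       (if i \<in> A \<and> j \<in> A
        then complex_of_real c * (diag_proj m A * (M - diag_part M) * diag_proj m A) $$ (i, j) else 0)"
      unfolding index_compression[OF S ij] index_compression[OF MD ij']
      using S zd ij ent[OF ij] by (auto simp: zero_diagonal_def)
  qed
  then show ?thesis using c by simp
qed

text \<open>
  \<open>S\<close> coincides off the diagonal with \<open>c\<close> times a corner of a member \<open>M\<close> of the class. The diagonal of \<open>M\<close>
  is left free, which is what makes room for unit diagonals, projections and unitaries. The factor \<open>c\<close>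
  enters only through its product with the norm of the off-diagonal part.
\<close>

definition contraction_dilates_into :: "complex mat set \<Rightarrow> real \<Rightarrow> complex mat \<Rightarrow> bool" where
  "contraction_dilates_into C K S \<longleftrightarrow>
    (\<exists>m\<ge>dim_row S. \<exists>M\<in>C \<inter> carrier_mat m m. \<exists>c\<ge>0.
      (\<forall>i<dim_row S. \<forall>j<dim_row S. i \<noteq> j \<longrightarrow> S $$ (i, j) = complex_of_real c * M $$ (i, j)) \<and>
      c * op_norm (M - diag_part M) \<le> K)"

text \<open>
  The class is paved at the level \<open>\<epsilon> / K\<close>, since the passage to the corner loses at most the factor \<open>K\<close>.
\<close>

lemma hermitian_paving:
  assumes C: "satisfies_paving C" and K: "0 < K"
    and dil: "\<And>n S. S \<in> carrier_mat n n \<Longrightarrow> mat_adjoint S = S \<Longrightarrow> zero_diagonal S \<Longrightarrow>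
      op_norm S \<le> 1 \<Longrightarrow> contraction_dilates_into C K S"
    and \<epsilon>: "0 < \<epsilon>"
  shows "\<exists>r. \<forall>n. \<forall>S\<in>carrier_mat n n. mat_adjoint S = S \<longrightarrow> zero_diagonal S \<longrightarrow> op_norm S \<le> 1 \<longrightarrow>
    (\<exists>A. index_partition n r A \<and> (\<forall>j<r. op_norm (diag_proj n (A j) * S * diag_proj n (A j)) \<le> \<epsilon>))"
proof -
  have "0 < \<epsilon> / K" using \<epsilon> K by simp
  then obtain r where r: "\<And>m M. M \<in> C \<inter> carrier_mat m m \<Longrightarrow>
      \<exists>A. index_partition m r A \<and> (\<forall>j<r. op_norm (diag_proj m (A j) * (M - diag_part M) * diag_proj m (A j))
        \<le> \<epsilon> / K * op_norm (M - diag_part M))"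
    using C unfolding satisfies_paving_def by blast
  show ?thesis
  proof (rule exI[of _ r], intro allI ballI impI)
    fix n S assume S: "S \<in> carrier_mat n n" and hS: "mat_adjoint S = S" "zero_diagonal S" "op_norm S \<le> 1"
    obtain m M c where m: "n \<le> m" and M: "M \<in> C \<inter> carrier_mat m m" and c: "0 \<le> c"
      and ent: "\<And>i j. i < n \<Longrightarrow> j < n \<Longrightarrow> i \<noteq> j \<Longrightarrow> S $$ (i, j) = complex_of_real c * M $$ (i, j)"
      and cK: "c * op_norm (M - diag_part M) \<le> K"
      using dil[OF S hS] S unfolding contraction_dilates_into_def by auto
    obtain A where A: "index_partition m r A"
      and pave: "\<And>j. j < r \<Longrightarrow> op_norm (diag_proj m (A j) * (M - diag_part M) * diag_proj m (A j))
        \<le> \<epsilon> / K * op_norm (M - diag_part M)"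
      using r[OF M] by blast
    have "op_norm (diag_proj n (A j \<inter> {..<n}) * S * diag_proj n (A j \<inter> {..<n})) \<le> \<epsilon>" if "j < r" for j
    proof -
      have "op_norm (diag_proj n (A j \<inter> {..<n}) * S * diag_proj n (A j \<inter> {..<n}))
        \<le> c * op_norm (diag_proj m (A j) * (M - diag_part M) * diag_proj m (A j))"
        using M by (intro paving_by_dilation[OF _ S m c hS(2) ent]) auto
      also have "\<dots> \<le> c * (\<epsilon> / K * op_norm (M - diag_part M))"
        by (intro mult_left_mono pave that c)
      also have "\<dots> = \<epsilon> / K * (c * op_norm (M - diag_part M))" by simp
      also have "\<dots> \<le> \<epsilon> / K * K"
        using \<epsilon> K by (intro mult_left_mono cK) auto
      finally show ?thesis using K by simp
    qed
    then show "\<exists>A. index_partition n r A \<and> (\<forall>j<r. op_norm (diag_proj n (A j) * S * diag_proj n (A j)) \<le> \<epsilon>)"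
      using index_partition_restrict[OF A m] by blast
  qed
qed

text \<open>
  \<open>R\<close> and \<open>\<i> J\<close> are the self-adjoint and skew-adjoint parts of \<open>T / op_norm T\<close>. The case \<open>T = 0\<close> is included: division by
  zero then gives \<open>R = J = 0\<close>.
\<close>

lemma cartesian_decomposition:
  assumes T: "T \<in> carrier_mat n n" and zd: "zero_diagonal T"
  obtains R J where "R \<in> carrier_mat n n" "mat_adjoint R = R" "zero_diagonal R" "op_norm R \<le> 1"
    and "J \<in> carrier_mat n n" "mat_adjoint J = J" "zero_diagonal J" "op_norm J \<le> 1"
    and "T = of_real (op_norm T) \<cdot>\<^sub>m (R + \<i> \<cdot>\<^sub>m J)"
proof -
  define t where "t = op_norm T"
  have t: "0 \<le> t" by (simp add: t_def op_norm_nonneg)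
  have unit: "op_norm (complex_of_real (1 / (2 * t)) \<cdot>\<^sub>m (a \<cdot>\<^sub>m T + b \<cdot>\<^sub>m mat_adjoint T)) \<le> 1"
    if "cmod a = 1" "cmod b = 1" for a b
  proof -
    have "op_norm (a \<cdot>\<^sub>m T + b \<cdot>\<^sub>m mat_adjoint T) \<le> op_norm (a \<cdot>\<^sub>m T) + op_norm (b \<cdot>\<^sub>m mat_adjoint T)"
      using T by (intro op_norm_add[where m = n and n = n]) auto
    also have "\<dots> \<le> t + t"
      using op_norm_smult_le[OF T, of a] op_norm_smult_le[OF mat_adjoint_carrier[OF T], of b]
        op_norm_adjoint[OF T] that by (simp add: t_def)
    finally have *: "op_norm (a \<cdot>\<^sub>m T + b \<cdot>\<^sub>m mat_adjoint T) \<le> 2 * t" by simp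
    have "op_norm (complex_of_real (1 / (2 * t)) \<cdot>\<^sub>m (a \<cdot>\<^sub>m T + b \<cdot>\<^sub>m mat_adjoint T))
        \<le> 1 / (2 * t) * op_norm (a \<cdot>\<^sub>m T + b \<cdot>\<^sub>m mat_adjoint T)"
      using op_norm_smult_le[of "a \<cdot>\<^sub>m T + b \<cdot>\<^sub>m mat_adjoint T" n "complex_of_real (1 / (2 * t))"] T t
      by (simp add: norm_divide)
    also have "\<dots> \<le> 1 / (2 * t) * (2 * t)"
      using t by (intro mult_left_mono *) auto
    also have "\<dots> \<le> 1" by simp
    finally show ?thesis .
  qed
  define R where "R = complex_of_real (1 / (2 * t)) \<cdot>\<^sub>m (1 \<cdot>\<^sub>m T + 1 \<cdot>\<^sub>m mat_adjoint T)"
  define J where "J = complex_of_real (1 / (2 * t)) \<cdot>\<^sub>m ((- \<i>) \<cdot>\<^sub>m T + \<i> \<cdot>\<^sub>m mat_adjoint T)"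
  have c: "R \<in> carrier_mat n n" "J \<in> carrier_mat n n" using T by (auto simp: R_def J_def)
  have entR: "R $$ (i, j) = (T $$ (i, j) + cnj (T $$ (j, i))) / of_real (2 * t)"
    and entJ: "J $$ (i, j) = \<i> * (cnj (T $$ (j, i)) - T $$ (i, j)) / of_real (2 * t)"
    if "i < n" "j < n" for i j
    using T that
    by (simp_all add: R_def J_def add_divide_distrib diff_divide_distrib right_diff_distrib)
  show thesis
  proof (rule that[of R J])
    show "R \<in> carrier_mat n n" "J \<in> carrier_mat n n" by (fact c)+
    show "op_norm R \<le> 1" "op_norm J \<le> 1" unfolding R_def J_def by (intro unit; simp)+
    show "mat_adjoint R = R" "mat_adjoint J = J"
      using c by (auto intro!: eq_matI simp: entR entJ algebra_simps)
    show "zero_diagonal R" "zero_diagonal J"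
      using c T zd by (auto simp: zero_diagonal_def entR entJ)
    show "T = of_real (op_norm T) \<cdot>\<^sub>m (R + \<i> \<cdot>\<^sub>m J)"
    proof (rule eq_matI)
      fix i j assume "i < dim_row (of_real (op_norm T) \<cdot>\<^sub>m (R + \<i> \<cdot>\<^sub>m J))"
        "j < dim_col (of_real (op_norm T) \<cdot>\<^sub>m (R + \<i> \<cdot>\<^sub>m J))"
      then have ij: "i < n" "j < n" using c by auto
      have "t = 0 \<Longrightarrow> T $$ (i, j) = 0"
        using entry_le_op_norm[OF T ij] by (simp add: t_def)
      moreover have "t \<noteq> 0 \<Longrightarrow> of_real t * (R $$ (i, j) + \<i> * J $$ (i, j)) = T $$ (i, j)"
        using ij by (simp add: entR entJ field_simps)
      ultimately show "T $$ (i, j) = (of_real (op_norm T) \<cdot>\<^sub>m (R + \<i> \<cdot>\<^sub>m J)) $$ (i, j)"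
        using ij c unfolding t_def[symmetric] by (cases "t = 0") auto
    qed (use c T in auto)
  qed
qed

text \<open>
  A paving of \<open>R\<close> and one of \<open>J\<close>, both at the level \<open>\<epsilon> / 2\<close>, have a common refinement with \<open>r * r\<close> parts,
  and shrinking a part does not increase the norm of a compression. So every compression of
  \<open>T = op_norm T * (R + \<i> J)\<close> has norm at most \<open>op_norm T * (\<epsilon> / 2 + \<epsilon> / 2)\<close>.
\<close>

lemma paving_conjecture_from_dilations:
  assumes C: "satisfies_paving C" and K: "0 < K"
    and dil: "\<And>n S. S \<in> carrier_mat n n \<Longrightarrow> mat_adjoint S = S \<Longrightarrow> zero_diagonal S \<Longrightarrow>
      op_norm S \<le> 1 \<Longrightarrow> contraction_dilates_into C K S"
  shows paving_conjecture
  unfolding paving_conjecture_def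
proof (intro allI impI)
  fix \<epsilon> :: real assume "0 < \<epsilon>"
  then have half: "0 < \<epsilon> / 2" by simp
  obtain r where r: "\<forall>n. \<forall>S\<in>carrier_mat n n. mat_adjoint S = S \<longrightarrow> zero_diagonal S \<longrightarrow>
      op_norm S \<le> 1 \<longrightarrow> (\<exists>A. index_partition n r A \<and>
        (\<forall>j<r. op_norm (diag_proj n (A j) * S * diag_proj n (A j)) \<le> \<epsilon> / 2))"
    using hermitian_paving[OF C K dil half] by (rule exE)
  show "\<exists>r. \<forall>n. \<forall>T\<in>carrier_mat n n. zero_diagonal T \<longrightarrow>
    (\<exists>A. index_partition n r A \<and>
      (\<forall>j<r. op_norm (diag_proj n (A j) * T * diag_proj n (A j)) \<le> \<epsilon> * op_norm T))"
  proof (rule exI[of _ "r * r"], intro allI ballI impI)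
    fix n T assume T: "T \<in> carrier_mat n n" and zd: "zero_diagonal T"
    define t where "t = op_norm T"
    obtain R J where R: "R \<in> carrier_mat n n" "mat_adjoint R = R" "zero_diagonal R" "op_norm R \<le> 1"
      and J: "J \<in> carrier_mat n n" "mat_adjoint J = J" "zero_diagonal J" "op_norm J \<le> 1"
      and TRJ: "T = of_real t \<cdot>\<^sub>m (R + \<i> \<cdot>\<^sub>m J)"
      using cartesian_decomposition[OF T zd] unfolding t_def by blast
    obtain A where A: "index_partition n r A"
      and pA: "\<And>j. j < r \<Longrightarrow> op_norm (diag_proj n (A j) * R * diag_proj n (A j)) \<le> \<epsilon> / 2"
      using r[rule_format, OF R] by blast
    obtain B where B: "index_partition n r B"
      and pB: "\<And>j. j < r \<Longrightarrow> op_norm (diag_proj n (B j) * J * diag_proj n (B j)) \<le> \<epsilon> / 2"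
      using r[rule_format, OF J] by blast
    have "op_norm (diag_proj n (A (j div r) \<inter> B (j mod r)) * T * diag_proj n (A (j div r) \<inter> B (j mod r)))
      \<le> \<epsilon> * t" if j: "j < r * r" for j
    proof -
      have bd: "j div r < r" "j mod r < r"
        using j by (auto simp: less_mult_imp_div_less intro!: mod_less_divisor Nat.gr0I)
      define D where "D = A (j div r) \<inter> B (j mod r)"
      let ?q = "\<lambda>S. diag_proj n D * S * diag_proj n D"
      have "?q T = of_real t \<cdot>\<^sub>m (?q R + \<i> \<cdot>\<^sub>m ?q J)"
        unfolding TRJ by (rule compression_linear[OF R(1) J(1)])
      then have "op_norm (?q T) \<le> t * op_norm (?q R + \<i> \<cdot>\<^sub>m ?q J)"
        using op_norm_smult_le[of "?q R + \<i> \<cdot>\<^sub>m ?q J" n "of_real t"] R(1) J(1) op_norm_nonneg[of T]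
        by (simp add: t_def)
      also have "\<dots> \<le> t * (\<epsilon> / 2 + \<epsilon> / 2)"
      proof (rule mult_left_mono)
        have "op_norm (?q R + \<i> \<cdot>\<^sub>m ?q J) \<le> op_norm (?q R) + op_norm (\<i> \<cdot>\<^sub>m ?q J)"
          using R(1) J(1) by (intro op_norm_add[where m = n and n = n]) auto
        also have "op_norm (?q R) \<le> \<epsilon> / 2"
          using compression_mono[OF _ R(1), of D "A (j div r)"] pA[OF bd(1)] by (auto simp: D_def)
        also have "op_norm (\<i> \<cdot>\<^sub>m ?q J) \<le> op_norm (?q J)"
          using op_norm_smult_le[of "?q J" n \<i>] J(1) by simp
        also have "op_norm (?q J) \<le> \<epsilon> / 2"
          using compression_mono[OF _ J(1), of D "B (j mod r)"] pB[OF bd(2)] by (auto simp: D_def)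
        finally show "op_norm (?q R + \<i> \<cdot>\<^sub>m ?q J) \<le> \<epsilon> / 2 + \<epsilon> / 2" by simp
      qed (simp add: t_def op_norm_nonneg)
      finally show ?thesis by (simp add: D_def mult.commute)
    qed
    then show "\<exists>A. index_partition n (r * r) A \<and>
        (\<forall>j<r * r. op_norm (diag_proj n (A j) * T * diag_proj n (A j)) \<le> \<epsilon> * op_norm T)"
      using index_partition_refine[OF A B] unfolding t_def by blast
  qed
qed

section \<open>Classes of operators that decide the conjecture\<close>

lemma satisfies_paving_antimono:
  assumes D: "satisfies_paving D" and sub: "C \<subseteq> D"
  shows "satisfies_paving C"
  unfolding satisfies_paving_def
proof (intro allI impI)
  fix \<epsilon> :: real assume "0 < \<epsilon>"
  with D obtain r where r: "\<forall>n. \<forall>T\<in>D \<inter> carrier_mat n n. \<exists>A. index_partition n r A \<and>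
      (\<forall>j<r. op_norm (diag_proj n (A j) * (T - diag_part T) * diag_proj n (A j))
        \<le> \<epsilon> * op_norm (T - diag_part T))"
    unfolding satisfies_paving_def by (elim allE[of _ \<epsilon>] impE exE) simp_all
  show "\<exists>r. \<forall>n. \<forall>T\<in>C \<inter> carrier_mat n n. \<exists>A. index_partition n r A \<and>
      (\<forall>j<r. op_norm (diag_proj n (A j) * (T - diag_part T) * diag_proj n (A j))
        \<le> \<epsilon> * op_norm (T - diag_part T))"
    by (rule exI[of _ r], intro allI ballI r[rule_format]) (use sub in auto)
qed

lemma contraction_dilates_intoI:
  assumes "S \<in> carrier_mat n n" "n \<le> m" "M \<in> C" "M \<in> carrier_mat m m" "0 \<le> c"
    and "\<And>i j. i < n \<Longrightarrow> j < n \<Longrightarrow> i \<noteq> j \<Longrightarrow> S $$ (i, j) = complex_of_real c * M $$ (i, j)"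
    and "c * op_norm (M - diag_part M) \<le> K"
  shows "contraction_dilates_into C K S"
  unfolding contraction_dilates_into_def carrier_matD(1)[OF assms(1)]
  by (rule exI[of _ m], rule conjI[OF assms(2)], rule bexI[of _ M], rule exI[of _ c])
    (use assms in simp_all)

text \<open>
  \<open>K = 4\<close>: the corner enters with \<open>c = 2\<close>, and removing the diagonal of a contraction leaves norm at most \<open>2\<close>.
\<close>

lemma paving_conjecture_from_projections:
  assumes "satisfies_paving orthogonal_projections"
  shows paving_conjecture
proof (rule paving_conjecture_from_dilations[OF assms, of 4])
  fix n S assume S: "S \<in> carrier_mat n n" "mat_adjoint S = S" "zero_diagonal S" "op_norm S \<le> 1"
  obtain P where P: "P \<in> carrier_mat (n + n) (n + n)" "P \<in> orthogonal_projections"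
    and ent: "\<And>i j. i < n \<Longrightarrow> j < n \<Longrightarrow> i \<noteq> j \<Longrightarrow> S $$ (i, j) = 2 * P $$ (i, j)"
    using half_shift_projection[OF S(1,2,4)] by blast
  show "contraction_dilates_into orthogonal_projections 4 S"
    by (rule contraction_dilates_intoI[OF S(1) _ P(2,1), of 2])
      (use ent op_norm_off_diagonal[OF P(1) projection_contraction[OF P]] in auto)
qed simp

text \<open>
  Off the diagonal the reflection \<open>2 P - 1\<close> is \<open>2 P\<close>, so here \<open>c = 1\<close>.
\<close>

lemma paving_conjecture_from_unitaries:
  assumes "satisfies_paving unitary_ops"
  shows paving_conjecture
proof (rule paving_conjecture_from_dilations[OF assms, of 2])
  fix n S assume S: "S \<in> carrier_mat n n" "mat_adjoint S = S" "zero_diagonal S" "op_norm S \<le> 1"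
  obtain P where P: "P \<in> carrier_mat (n + n) (n + n)" "P \<in> orthogonal_projections"
    and ent: "\<And>i j. i < n \<Longrightarrow> j < n \<Longrightarrow> i \<noteq> j \<Longrightarrow> S $$ (i, j) = 2 * P $$ (i, j)"
    using half_shift_projection[OF S(1,2,4)] by blast
  define U where "U = 2 \<cdot>\<^sub>m P + (- 1) \<cdot>\<^sub>m 1\<^sub>m (n + n)"
  have U: "U \<in> carrier_mat (n + n) (n + n)" "U \<in> unitary_ops"
    using P projection_reflection_unitary[OF P] by (auto simp: U_def)
  show "contraction_dilates_into unitary_ops 2 S"
    by (rule contraction_dilates_intoI[OF S(1) _ U(2,1), of 1])
      (use P ent op_norm_off_diagonal[OF U(1) unitary_contraction[OF U]] in \<open>auto simp: U_def\<close>)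
qed simp

lemma paving_conjecture_from_gram:
  assumes "satisfies_paving unit_gram_matrices"
  shows paving_conjecture
proof (rule paving_conjecture_from_dilations[OF assms, of 1])
  fix n S assume S: "S \<in> carrier_mat n n" "mat_adjoint S = S" "zero_diagonal S" "op_norm S \<le> 1"
  have "(1\<^sub>m n + S) - diag_part (1\<^sub>m n + S) = S"
    using S(1,3) by (intro eq_matI) (simp_all add: diag_part_def zero_diagonal_def)
  then have "1 * op_norm ((1\<^sub>m n + S) - diag_part (1\<^sub>m n + S)) \<le> 1"
    using S(4) by simp
  then show "contraction_dilates_into unit_gram_matrices 1 S"
    by (intro contraction_dilates_intoI[OF S(1) order_refl gram_dilation[OF S], of 1])
      (use S(1) in simp_all)
qed simp

lemma paving_conjecture_from_invertible_zero_diagonal: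
  assumes "satisfies_paving invertible_zero_diagonal_ops"
  shows paving_conjecture
proof (rule paving_conjecture_from_dilations[OF assms, of 3])
  fix n S assume S: "S \<in> carrier_mat n n" "mat_adjoint S = S" "zero_diagonal S" "op_norm S \<le> 1"
  note dil = invertible_zero_diagonal_dilation[OF S(1,3,4)]
  show "contraction_dilates_into invertible_zero_diagonal_ops 3 S"
    by (rule contraction_dilates_intoI[OF S(1) _ dil(1), of "n + n" 1]) (use S(1) dil(2) in simp_all)
qed simp

lemma projections_positive: "orthogonal_projections \<subseteq> positive_ops"
proof
  fix P assume pr: "P \<in> orthogonal_projections"
  define n where "n = dim_row P"
  have P: "P \<in> carrier_mat n n" and PP: "P * P = P" "mat_adjoint P = P"
    using pr by (auto simp: orthogonal_projections_def n_def)
  have "0 \<le> (P *\<^sub>v v) \<bullet>c v" if v: "v \<in> carrier_vec n" for v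
  proof -
    have "(P *\<^sub>v v) \<bullet>c v = (P *\<^sub>v (P *\<^sub>v v)) \<bullet>c v"
      using assoc_mult_mat_vec[OF P P v] PP by simp
    also have "\<dots> = (P *\<^sub>v v) \<bullet>c (P *\<^sub>v v)"
      using inner_adjoint[OF P mult_mat_vec_carrier[OF P v] v] PP by simp
    finally show ?thesis
      by (simp only: inner_self) (simp add: less_eq_complex_def power2_eq_square)
  qed
  then show "P \<in> positive_ops" using P by (auto simp: positive_ops_def)
qed

theorem theorem2p4:
  shows "(satisfies_paving unitary_ops \<longrightarrow> paving_conjecture) \<and>
         (satisfies_paving orthogonal_projections \<longrightarrow> paving_conjecture) \<and>
         (satisfies_paving positive_ops \<longrightarrow> paving_conjecture) \<and>
         (satisfies_paving self_adjoint_ops \<longrightarrow> paving_conjecture) \<and>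
         (satisfies_paving unit_gram_matrices \<longrightarrow> paving_conjecture) \<and>
         (satisfies_paving invertible_ops \<longrightarrow> paving_conjecture) \<and>
         (satisfies_paving invertible_zero_diagonal_ops \<longrightarrow> paving_conjecture)"
proof -
  have "orthogonal_projections \<subseteq> self_adjoint_ops"
    by (auto simp: orthogonal_projections_def self_adjoint_ops_def)
  moreover have "invertible_zero_diagonal_ops \<subseteq> invertible_ops"
    by (auto simp: invertible_zero_diagonal_ops_def invertible_ops_def)
  ultimately show ?thesis
    using projections_positive satisfies_paving_antimono paving_conjecture_from_projections
      paving_conjecture_from_unitaries paving_conjecture_from_gram
      paving_conjecture_from_invertible_zero_diagonal
    by blast
qed

end
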